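(* Let $\mathcal{E}=\{\epsilon_p(j),\ j\in[p],\ p\in\mathbb{N}\}$ be a uniformly relatively stable (URS) Gaussian triangular array with standard Normal marginals, and let $u_p=\Phi^{-1}(1-1/p)$. Let $f:\mathbb{R}\to\mathbb{R}$ be an even ($f(x)=f(-x)$), differentiable and eventually strictly increasing function with $\lim_{x\to\infty}f(x)\neq0$, which is monotone non-decreasing on $(0,\infty)$ and whose derivative $f'(x)$ is either eventually increasing or eventually decreasing as $x\to\infty$. Set $\eta_p(j)=f(\epsilon_p(j))$ and $v_p=f(u_p)$. Suppose that $\delta_p>0$, $\delta_p\to0$, is such that $$\mathbb{P}\left(\left|\frac{\max_{j\in[p]}\epsilon_p(j)}{u_p}-1\right|>\delta_p\right)\to 0,\quad\text{as } p\to\infty.$$ Then $$\mathbb{P}\left(\left|\frac{\max_{j\in[p]}\eta_p(j)}{v_p}-1\right|>d_p\right)\to 0,\quad\text{as } p\to\infty,$$ provided that $$d_p\geq d_p^{\star}:=\frac{u_p\delta_p\max\left\{|f'(u_p(1-\delta_p))|,\ |f'(u_p(1+\delta_p))|\right\}}{|f(u_p)|}.$$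
   Context: $[p]=\{1,\dots,p\}$; $\Phi$ is the standard Normal cumulative distribution function. A Gaussian triangular array with standard Normal marginals is a family $\{\epsilon_p(j),\ j\in[p],\ p\in\mathbb{N}\}$ such that, for each $p$, $(\epsilon_p(1),\dots,\epsilon_p(p))$ is jointly Gaussian (with arbitrary dependence) and each $\epsilon_p(j)\sim N(0,1)$. URS (uniform relative stability): for every sequence of subsets $S_p\subseteq\{1,\dots,p\}$ with $|S_p|\to\infty$, one has $\frac{1}{u_{|S_p|}}\max_{i\in S_p}\epsilon_p(i)\to 1$ in probability as $p\to\infty$. "Eventually" means on some half-line $[x_0,\infty)$. The limit $\lim_{x\to\infty}f(x)$ may be $+\infty$. All statements concern sufficiently large $p$, for which $u_p>0$ and $f(u_p)\neq0$. *)

theory Defs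
  imports "HOL-Probability.Probability"
begin

text \<open>Inverse of the standard Normal distribution function. The value \<open>inv \<Phi> q\<close> is meaningful for
  \<open>0 < q < 1\<close> only, so \<open>u 0\<close> and \<open>u 1\<close> are unspecified reals; \<open>u 2 = 0\<close> and \<open>u p > 0\<close> for \<open>p > 2\<close>.\<close>

definition std_normal_quantile :: "real \<Rightarrow> real" where
  "std_normal_quantile = inv (cdf std_normal_distribution)"

definition u :: "nat \<Rightarrow> real" where
  "u p = std_normal_quantile (1 - 1 / real p)"

text \<open>The Dirac measure is the Gaussian law of variance zero. It has to be admitted, since
  the covariance matrix of a jointly Gaussian family may be singular.\<close>

definition gaussian_law :: "real measure \<Rightarrow> bool" where
  "gaussian_law D \<longleftrightarrow>
     (\<exists>\<mu> \<sigma>. \<sigma> > 0 \<and> D = density lborel (normal_density \<mu> \<sigma>)) \<or> (\<exists>\<mu>. D = return borel \<mu>)"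

definition jointly_gaussian :: "'a measure \<Rightarrow> 'i set \<Rightarrow> ('i \<Rightarrow> 'a \<Rightarrow> real) \<Rightarrow> bool" where
  "jointly_gaussian M I X \<longleftrightarrow>
     (\<forall>i\<in>I. X i \<in> borel_measurable M) \<and>
     (\<forall>a. gaussian_law (distr M borel (\<lambda>\<omega>. \<Sum>i\<in>I. a i * X i \<omega>)))"

definition gaussian_array :: "'a measure \<Rightarrow> (nat \<Rightarrow> nat \<Rightarrow> 'a \<Rightarrow> real) \<Rightarrow> bool" where
  "gaussian_array M \<epsilon> \<longleftrightarrow>
     (\<forall>p. jointly_gaussian M {1..p} (\<epsilon> p) \<and>
          (\<forall>j\<in>{1..p}. distributed M lborel (\<epsilon> p j) std_normal_density))"

definition converges_in_prob :: "'a measure \<Rightarrow> (nat \<Rightarrow> 'a \<Rightarrow> real) \<Rightarrow> real \<Rightarrow> bool" where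
  "converges_in_prob M X c \<longleftrightarrow>
     (\<forall>e>0. (\<lambda>p. \<P>(\<omega> in M. \<bar>X p \<omega> - c\<bar> > e)) \<longlonglongrightarrow> 0)"

text \<open>Uniform relative stability. The maximum over an empty \<open>S p\<close> is an unspecified real,
  which is harmless because \<open>S p\<close> is nonempty for large \<open>p\<close>.\<close>

definition URS :: "'a measure \<Rightarrow> (nat \<Rightarrow> nat \<Rightarrow> 'a \<Rightarrow> real) \<Rightarrow> bool" where
  "URS M \<epsilon> \<longleftrightarrow>
     (\<forall>S :: nat \<Rightarrow> nat set.
        (\<forall>p. S p \<subseteq> {1..p}) \<longrightarrow> filterlim (\<lambda>p. card (S p)) at_top sequentially \<longrightarrow>
        converges_in_prob M (\<lambda>p \<omega>. 1 / u (card (S p)) * (MAX i\<in>S p. \<epsilon> p i \<omega>)) 1)"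

definition d_star :: "(real \<Rightarrow> real) \<Rightarrow> (nat \<Rightarrow> real) \<Rightarrow> nat \<Rightarrow> real" where
  "d_star f \<delta> p =
     u p * \<delta> p * max \<bar>deriv f (u p * (1 - \<delta> p))\<bar> \<bar>deriv f (u p * (1 + \<delta> p))\<bar> / \<bar>f (u p)\<bar>"

end

theory Submission
  imports Defs
begin

text \<open>
  Since \<open>f\<close> is even and nondecreasing on the positive half-line, the maximum of the \<open>f (\<epsilon> p j)\<close> is
  \<open>f m\<close>, where \<open>m\<close> is the maximum of the absolute values \<open>\<bar>\<epsilon> p j\<bar>\<close> (\<open>Max_even_monotone\<close>). If \<open>m\<close> lies
  between \<open>a = u p * (1 - \<delta> p)\<close> and \<open>b = u p * (1 + \<delta> p)\<close>, the mean value theorem bounds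
  \<open>\<bar>f m - f (u p)\<bar>\<close> by \<open>u p * \<delta> p\<close> times the supremum of \<open>\<bar>f'\<bar>\<close> on \<open>[a, b]\<close>. Because \<open>u p\<close> tends to
  infinity, \<open>f'\<close> is monotone on \<open>[a, b]\<close> for large \<open>p\<close>, so the supremum is attained at an end point
  (\<open>monotone_deriv_increment_bound\<close>), and division by \<open>\<bar>f (u p)\<bar>\<close> gives \<open>d_star f \<delta> p\<close>.

  It remains to see that \<open>m\<close> lies in \<open>[a, b]\<close> with probability tending to one. As \<open>m\<close> is the larger
  one of \<open>max \<epsilon>\<close> and \<open>max (- \<epsilon>)\<close>, it suffices that \<open>max \<epsilon>\<close> lies in \<open>[a, b]\<close>, which is the assumption on
  \<open>\<delta>\<close>, and that \<open>max (- \<epsilon>)\<close> does not exceed \<open>b\<close>. A union bound gives the latter only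
  if \<open>(u p)\<^sup>2 * \<delta> p\<close> tends to infinity. For every admissible \<open>\<delta>\<close> it follows from symmetry: \<open>- \<epsilon>\<close> and \<open>\<epsilon>\<close>
  have the same joint law, so \<open>max (- \<epsilon>)\<close> exceeds \<open>b\<close> with the same probability as \<open>max \<epsilon>\<close>
  (\<open>prob_Max_uminus_gt\<close>).

  Joint Gaussianity speaks of the laws of linear combinations only, so the symmetry of the joint law
  rests on the Cramer--Wold principle (\<open>cramer_wold\<close>). It is derived from the one-dimensional uniqueness
  theorem for characteristic functions by replacing, one coordinate after the other, a factor
  \<open>exp (\<i> * a * X)\<close> by an indicator of \<open>X\<close>.
\<close>

section \<open>Uniqueness of weighted laws on the line\<close>

text \<open>Reweighting \<open>M\<close> by a nonnegative \<open>w\<close> of mean one turns weighted expectations of functions of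
  \<open>X\<close> into integrals against an honest probability law \<open>D\<close> on the line, so that the uniqueness theorem
  of Levy for characteristic functions applies to them.\<close>

lemma weighted_law_properties:
  fixes w X :: "'a \<Rightarrow> real"
  assumes "prob_space M"
    and [measurable]: "X \<in> borel_measurable M" "w \<in> borel_measurable M"
    and nonneg: "\<And>\<omega>. 0 \<le> w \<omega>" and bound: "\<And>\<omega>. w \<omega> \<le> K"
    and total: "(LINT \<omega>|M. w \<omega>) = 1"
  defines "D \<equiv> distr (density M (\<lambda>\<omega>. ennreal (w \<omega>))) borel X"
  shows "real_distribution D"
    and "char D t = (CLINT \<omega>|M. of_real (w \<omega>) * iexp (t * X \<omega>))"
    and "B \<in> sets borel \<Longrightarrow> measure D B = (LINT \<omega>|M. w \<omega> * indicator B (X \<omega>))"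
proof -
  interpret prob_space M by fact
  have int: "integrable M w"
    by (rule integrable_const_bound[where B=K]) (use nonneg bound in auto)
  have "prob_space (density M (\<lambda>\<omega>. ennreal (w \<omega>)))"
  proof
    have "emeasure (density M (\<lambda>\<omega>. ennreal (w \<omega>))) (space M) = (\<integral>\<^sup>+\<omega>. ennreal (w \<omega>) \<partial>M)"
      by (subst emeasure_density) (auto intro!: nn_integral_cong)
    also have "\<dots> = 1"
      using nn_integral_eq_integral[OF int] nonneg total by simp
    finally show "emeasure (density M (\<lambda>\<omega>. ennreal (w \<omega>)))
        (space (density M (\<lambda>\<omega>. ennreal (w \<omega>)))) = 1" by simp
  qed
  then interpret w: prob_space "density M (\<lambda>\<omega>. ennreal (w \<omega>))" .
  show "real_distribution D"
    unfolding D_def by (rule w.real_distribution_distr) simp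
  then interpret D: real_distribution D .
  show "char D t = (CLINT \<omega>|M. of_real (w \<omega>) * iexp (t * X \<omega>))"
    unfolding char_def D_def
    by (simp add: integral_distr integral_density nonneg scaleR_conv_of_real)
  assume B [measurable]: "B \<in> sets borel"
  have "measure D B = (LINT x|D. indicator B x)"
    by (simp add: D_def)
  also have "\<dots> = (LINT \<omega>|M. w \<omega> * indicator B (X \<omega>))"
    unfolding D_def by (subst integral_distr; simp add: integral_density nonneg)
  finally show "measure D B = (LINT \<omega>|M. w \<omega> * indicator B (X \<omega>))" .
qed

lemma nonneg_weighted_uniqueness:
  fixes w X :: "'a \<Rightarrow> real" and v Y :: "'b \<Rightarrow> real"
  assumes M: "prob_space M" and N: "prob_space N"
    and X: "X \<in> borel_measurable M" and w: "w \<in> borel_measurable M"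
    and Y: "Y \<in> borel_measurable N" and v: "v \<in> borel_measurable N"
    and w_bounds: "\<And>\<omega>. 0 \<le> w \<omega>" "\<And>\<omega>. w \<omega> \<le> K"
    and v_bounds: "\<And>\<omega>. 0 \<le> v \<omega>" "\<And>\<omega>. v \<omega> \<le> K"
    and total: "(LINT \<omega>|M. w \<omega>) = 1" "(LINT \<omega>|N. v \<omega>) = 1"
    and eq: "\<And>t. (CLINT \<omega>|M. of_real (w \<omega>) * iexp (t * X \<omega>))
                = (CLINT \<omega>|N. of_real (v \<omega>) * iexp (t * Y \<omega>))"
    and B: "B \<in> sets borel"
  shows "(LINT \<omega>|M. w \<omega> * indicator B (X \<omega>)) = (LINT \<omega>|N. v \<omega> * indicator B (Y \<omega>))"
proof -
  note PX = weighted_law_properties[OF M X w w_bounds total(1)]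
  note PY = weighted_law_properties[OF N Y v v_bounds total(2)]
  have "distr (density M (\<lambda>\<omega>. ennreal (w \<omega>))) borel X
      = distr (density N (\<lambda>\<omega>. ennreal (v \<omega>))) borel Y"
    by (rule Levy_uniqueness[OF PX(1) PY(1)]) (intro ext, simp only: PX(2) PY(2) eq)
  then show ?thesis
    using PX(3)[OF B] PY(3)[OF B] by simp
qed

lemma integral_mult_add_div:
  fixes f g :: "'a \<Rightarrow> 'b :: {real_normed_field, banach, second_countable_topology}"
  assumes "integrable M f" and "integrable M g"
  shows "(LINT \<omega>|M. (a * f \<omega> + g \<omega>) / c) = (a * (LINT \<omega>|M. f \<omega>) + (LINT \<omega>|M. g \<omega>)) / c"
  using assms by simp

text \<open>The weights that arise below, an indicator times a cosine or a sine, change sign. Adding the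
  constant 2 makes such a weight positive and bounded away from zero, so that it can be normalised; the
  contribution of the constant is the unweighted law, which is determined by the same theorem, and it
  is subtracted at the end.\<close>

lemma signed_weighted_uniqueness:
  fixes W X :: "'a \<Rightarrow> real" and V Y :: "'b \<Rightarrow> real"
  assumes "prob_space M" and "prob_space N"
    and [measurable]: "X \<in> borel_measurable M" "W \<in> borel_measurable M"
    and [measurable]: "Y \<in> borel_measurable N" "V \<in> borel_measurable N"
    and W: "\<And>\<omega>. \<bar>W \<omega>\<bar> \<le> 1" and V: "\<And>\<omega>. \<bar>V \<omega>\<bar> \<le> 1"
    and plain: "\<And>t. (CLINT \<omega>|M. iexp (t * X \<omega>)) = (CLINT \<omega>|N. iexp (t * Y \<omega>))"
    and weighted: "\<And>t. (CLINT \<omega>|M. of_real (W \<omega>) * iexp (t * X \<omega>))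
                      = (CLINT \<omega>|N. of_real (V \<omega>) * iexp (t * Y \<omega>))"
    and B [measurable]: "B \<in> sets borel"
  shows "(LINT \<omega>|M. W \<omega> * indicator B (X \<omega>)) = (LINT \<omega>|N. V \<omega> * indicator B (Y \<omega>))"
proof -
  interpret M: prob_space M by fact
  interpret N: prob_space N by fact
  have intM: "integrable M g" if "g \<in> borel_measurable M" "\<And>\<omega>. norm (g \<omega>) \<le> 1"
    for g :: "'a \<Rightarrow> 'c::{banach, second_countable_topology}"
    by (rule M.integrable_const_bound[where B=1]) (use that in auto)
  have intN: "integrable N g" if "g \<in> borel_measurable N" "\<And>\<omega>. norm (g \<omega>) \<le> 1"
    for g :: "'b \<Rightarrow> 'c::{banach, second_countable_topology}"
    by (rule N.integrable_const_bound[where B=1]) (use that in auto)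
  have integrable_M: "integrable M W" "integrable M (\<lambda>\<omega>. indicator B (X \<omega>) :: real)"
      "integrable M (\<lambda>\<omega>. W \<omega> * indicator B (X \<omega>))" "integrable M (\<lambda>\<omega>. iexp (t * X \<omega>))"
      "integrable M (\<lambda>\<omega>. of_real (W \<omega>) * iexp (t * X \<omega>))" for t
    by (rule intM; use W in \<open>auto simp: indicator_def norm_mult\<close>)+
  have integrable_N: "integrable N V" "integrable N (\<lambda>\<omega>. indicator B (Y \<omega>) :: real)"
      "integrable N (\<lambda>\<omega>. V \<omega> * indicator B (Y \<omega>))" "integrable N (\<lambda>\<omega>. iexp (t * Y \<omega>))"
      "integrable N (\<lambda>\<omega>. of_real (V \<omega>) * iexp (t * Y \<omega>))" for t
    by (rule intN; use V in \<open>auto simp: indicator_def norm_mult\<close>)+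
  note [simp] = integrable_M(1) integrable_N(1)
  define c where "c = 2 + (LINT \<omega>|M. W \<omega>)"
  \<comment> \<open>Both sides have the same normalising constant: compare the weighted transforms at zero.\<close>
  have cV: "c = 2 + (LINT \<omega>|N. V \<omega>)"
    using weighted[of 0] by (simp add: c_def)
  have "- 1 \<le> (LINT \<omega>|M. W \<omega>)"
    using integral_mono[of M "\<lambda>_. -1" W] W by (simp add: abs_le_iff M.prob_space minus_le_iff)
  then have c: "c \<ge> 1" by (simp add: c_def)
  let ?w = "\<lambda>\<omega>. (2 + W \<omega>) / c" and ?v = "\<lambda>\<omega>. (2 + V \<omega>) / c"
  have bounds: "0 \<le> (2 + a) / c" "(2 + a) / c \<le> 3" if "\<bar>a\<bar> \<le> 1" for a
  proof -
    show "0 \<le> (2 + a) / c" using that c by simp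
    have "2 + a \<le> 3 * c" using that c by linarith
    then show "(2 + a) / c \<le> 3" using c by (simp add: divide_le_eq)
  qed
  have tilt: "(LINT \<omega>|M. ?w \<omega> * indicator B (X \<omega>)) = (LINT \<omega>|N. ?v \<omega> * indicator B (Y \<omega>))"
  proof (rule nonneg_weighted_uniqueness[where K=3])
    show "(LINT \<omega>|M. ?w \<omega>) = 1"
      using c by (simp add: c_def M.prob_space)
    show "(LINT \<omega>|N. ?v \<omega>) = 1"
      using c by (simp add: cV N.prob_space)
    fix t
    have "(CLINT \<omega>|M. of_real (?w \<omega>) * iexp (t * X \<omega>))
        = (CLINT \<omega>|M. (2 * iexp (t * X \<omega>) + of_real (W \<omega>) * iexp (t * X \<omega>)) / of_real c)"
      by (simp add: add_divide_distrib distrib_right)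
    also have "\<dots> = (2 * (CLINT \<omega>|M. iexp (t * X \<omega>))
        + (CLINT \<omega>|M. of_real (W \<omega>) * iexp (t * X \<omega>))) / of_real c"
      by (rule integral_mult_add_div[OF integrable_M(4,5)])
    also have "\<dots> = (2 * (CLINT \<omega>|N. iexp (t * Y \<omega>))
        + (CLINT \<omega>|N. of_real (V \<omega>) * iexp (t * Y \<omega>))) / of_real c"
      by (simp only: plain weighted)
    also have "\<dots> = (CLINT \<omega>|N. (2 * iexp (t * Y \<omega>) + of_real (V \<omega>) * iexp (t * Y \<omega>)) / of_real c)"
      by (rule integral_mult_add_div[OF integrable_N(4,5), symmetric])
    also have "\<dots> = (CLINT \<omega>|N. of_real (?v \<omega>) * iexp (t * Y \<omega>))"
      by (simp add: add_divide_distrib distrib_right)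
    finally show "(CLINT \<omega>|M. of_real (?w \<omega>) * iexp (t * X \<omega>))
        = (CLINT \<omega>|N. of_real (?v \<omega>) * iexp (t * Y \<omega>))" .
  qed (use assms bounds in auto)
  have law: "(LINT \<omega>|M. (1::real) * indicator B (X \<omega>)) = (LINT \<omega>|N. (1::real) * indicator B (Y \<omega>))"
    by (rule nonneg_weighted_uniqueness[where K=1 and w="\<lambda>_. 1" and v="\<lambda>_. 1"])
       (use assms in \<open>auto simp: M.prob_space N.prob_space\<close>)
  have splitM: "(LINT \<omega>|M. ?w \<omega> * indicator B (X \<omega>))
      = (2 * (LINT \<omega>|M. indicator B (X \<omega>)) + (LINT \<omega>|M. W \<omega> * indicator B (X \<omega>))) / c"
  proof -
    have "(LINT \<omega>|M. ?w \<omega> * indicator B (X \<omega>))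
        = (LINT \<omega>|M. (2 * indicator B (X \<omega>) + W \<omega> * indicator B (X \<omega>)) / c)"
      by (simp add: add_divide_distrib distrib_right)
    then show ?thesis by (simp only: integral_mult_add_div[OF integrable_M(2,3)])
  qed
  have splitN: "(LINT \<omega>|N. ?v \<omega> * indicator B (Y \<omega>))
      = (2 * (LINT \<omega>|N. indicator B (Y \<omega>)) + (LINT \<omega>|N. V \<omega> * indicator B (Y \<omega>))) / c"
  proof -
    have "(LINT \<omega>|N. ?v \<omega> * indicator B (Y \<omega>))
        = (LINT \<omega>|N. (2 * indicator B (Y \<omega>) + V \<omega> * indicator B (Y \<omega>)) / c)"
      by (simp add: add_divide_distrib distrib_right)
    then show ?thesis by (simp only: integral_mult_add_div[OF integrable_N(2,3)])
  qed
  show ?thesis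
    using tilt law c unfolding splitM splitN by simp
qed

section \<open>The Cramer--Wold principle\<close>

text \<open>The coordinates in \<open>J\<close> are converted one at a time from transform to indicator. The phase keeps
  running over all of \<open>I\<close>, so varying the coefficient of coordinate \<open>k\<close> yields the one-dimensional
  transform of \<open>X k\<close> under the weights (indicators over \<open>J\<close>) times the cosine or sine of the phase;
  one-dimensional uniqueness then inserts the indicator of \<open>B k\<close>, and Euler's formula restores the phase.\<close>

lemma indicator_iexp_uniqueness:
  fixes X :: "'i \<Rightarrow> 'a \<Rightarrow> real" and Y :: "'i \<Rightarrow> 'b \<Rightarrow> real"
  assumes "prob_space M" and "prob_space N" and I: "finite I"
    and [measurable]: "\<And>i. i \<in> I \<Longrightarrow> X i \<in> borel_measurable M"
      "\<And>i. i \<in> I \<Longrightarrow> Y i \<in> borel_measurable N"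
    and eq: "\<And>a. (CLINT \<omega>|M. iexp (\<Sum>i\<in>I. a i * X i \<omega>)) = (CLINT \<omega>|N. iexp (\<Sum>i\<in>I. a i * Y i \<omega>))"
    and [measurable]: "\<And>i. B i \<in> sets (borel :: real measure)"
    and J: "J \<subseteq> I"
  shows "(CLINT \<omega>|M. of_real (\<Prod>j\<in>J. indicator (B j) (X j \<omega>)) * iexp (\<Sum>i\<in>I. a i * X i \<omega>))
       = (CLINT \<omega>|N. of_real (\<Prod>j\<in>J. indicator (B j) (Y j \<omega>)) * iexp (\<Sum>i\<in>I. a i * Y i \<omega>))"
  using finite_subset[OF J I] J
proof (induction J arbitrary: a rule: finite_induct)
  case empty
  then show ?case using eq by simp
next
  case (insert k J)
  interpret M: prob_space M by fact
  interpret N: prob_space N by fact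
  have k: "k \<in> I" and J: "J \<subseteq> I" using insert.prems by auto
  have [measurable]: "X k \<in> borel_measurable M" "Y k \<in> borel_measurable N"
      "\<And>j. j \<in> J \<Longrightarrow> X j \<in> borel_measurable M" "\<And>j. j \<in> J \<Longrightarrow> Y j \<in> borel_measurable N"
    using assms(4,5) k J by auto
  let ?P = "\<lambda>\<omega>. \<Prod>j\<in>J. indicator (B j) (X j \<omega>) :: real"
  let ?Q = "\<lambda>\<omega>. \<Prod>j\<in>J. indicator (B j) (Y j \<omega>) :: real"
  let ?S = "\<lambda>a \<omega>. \<Sum>i\<in>I. a i * X i \<omega>" and ?T = "\<lambda>a \<omega>. \<Sum>i\<in>I. a i * Y i \<omega>"
  have P01: "\<bar>?P \<omega>\<bar> \<le> 1" for \<omega>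
    unfolding abs_prod by (rule prod_le_1) (auto simp: indicator_def)
  have Q01: "\<bar>?Q \<omega>\<bar> \<le> 1" for \<omega>
    unfolding abs_prod by (rule prod_le_1) (auto simp: indicator_def)
  have bM: "integrable M g" if "g \<in> borel_measurable M" "\<And>\<omega>. norm (g \<omega>) \<le> 1"
    for g :: "'a \<Rightarrow> 'c::{banach, second_countable_topology}"
    by (rule M.integrable_const_bound[where B=1]) (use that in auto)
  have bN: "integrable N g" if "g \<in> borel_measurable N" "\<And>\<omega>. norm (g \<omega>) \<le> 1"
    for g :: "'b \<Rightarrow> 'c::{banach, second_countable_topology}"
    by (rule N.integrable_const_bound[where B=1]) (use that in auto)
  have intM [simp]: "integrable M (\<lambda>\<omega>. of_real (?P \<omega>) * iexp (?S b \<omega>))" for b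
    by (rule bM) (use P01 in \<open>simp_all add: norm_mult del: of_real_prod\<close>)
  have intN [simp]: "integrable N (\<lambda>\<omega>. of_real (?Q \<omega>) * iexp (?T b \<omega>))" for b
    by (rule bN) (use Q01 in \<open>simp_all add: norm_mult del: of_real_prod\<close>)
  have coord: "(\<Sum>i\<in>I. (b i + (if i = k then t else 0)) * Z i) = (\<Sum>i\<in>I. b i * Z i) + t * Z k"
    for b Z :: "'i \<Rightarrow> real" and t
    using I k by (simp add: distrib_right sum.distrib if_distrib[of "\<lambda>x. x * _"] cong: if_cong)
  have shift: "(CLINT \<omega>|M. of_real (?P \<omega>) * iexp (?S b \<omega> + t * X k \<omega>))
      = (CLINT \<omega>|N. of_real (?Q \<omega>) * iexp (?T b \<omega> + t * Y k \<omega>))" for b t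
    using insert.IH[of "\<lambda>i. b i + (if i = k then t else 0)"] J
    by (simp only: coord)
  have intM' [simp]: "integrable M (\<lambda>\<omega>. of_real (?P \<omega>) * iexp (?S b \<omega> + t * X k \<omega>))" for b t
    using intM[of "\<lambda>i. b i + (if i = k then t else 0)"] by (simp only: coord)
  have intN' [simp]: "integrable N (\<lambda>\<omega>. of_real (?Q \<omega>) * iexp (?T b \<omega> + t * Y k \<omega>))" for b t
    using intN[of "\<lambda>i. b i + (if i = k then t else 0)"] by (simp only: coord)
  have plain: "(CLINT \<omega>|M. iexp (t * X k \<omega>)) = (CLINT \<omega>|N. iexp (t * Y k \<omega>))" for t
    using eq[of "\<lambda>i. 0 + (if i = k then t else 0)"] unfolding coord by simp
  \<comment> \<open>Writing cosine and sine as combinations of two phases, \<open>s\<close> and \<open>- s\<close>, puts the weighted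
    transforms within reach of the induction hypothesis, which holds for all coefficient vectors.\<close>
  have trig_cos: "complex_of_real (p * cos s) * iexp r
      = (of_real p * iexp (s + r) + of_real p * iexp (- s + r)) / 2" for p s r
    by (simp add: cos_exp_eq cos_of_real[symmetric] exp_add exp_diff exp_minus field_simps)
  have trig_sin: "complex_of_real (p * sin s) * iexp r
      = (of_real p * iexp (s + r) - of_real p * iexp (- s + r)) / (2 * \<i>)" for p s r
    by (simp add: sin_exp_eq sin_of_real[symmetric] exp_add exp_diff exp_minus field_simps)
  have neg: "- (\<Sum>i\<in>I. a i * Z i) = (\<Sum>i\<in>I. (- a i) * Z i)" for Z :: "'i \<Rightarrow> real"
    by (simp add: sum_negf)
  have re: "(LINT \<omega>|M. (?P \<omega> * cos (?S a \<omega>)) * indicator (B k) (X k \<omega>))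
      = (LINT \<omega>|N. (?Q \<omega> * cos (?T a \<omega>)) * indicator (B k) (Y k \<omega>))"
  proof (rule signed_weighted_uniqueness[OF assms(1,2)])
    show "\<bar>?P \<omega> * cos (?S a \<omega>)\<bar> \<le> 1" for \<omega>
      using mult_mono[OF P01 abs_cos_le_one[of "?S a \<omega>"]] by (simp add: abs_mult)
    show "\<bar>?Q \<omega> * cos (?T a \<omega>)\<bar> \<le> 1" for \<omega>
      using mult_mono[OF Q01 abs_cos_le_one[of "?T a \<omega>"]] by (simp add: abs_mult)
    show "(CLINT \<omega>|M. of_real (?P \<omega> * cos (?S a \<omega>)) * iexp (t * X k \<omega>))
        = (CLINT \<omega>|N. of_real (?Q \<omega> * cos (?T a \<omega>)) * iexp (t * Y k \<omega>))" for t
      unfolding trig_cos unfolding neg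
      by (simp only: integral_divide_zero Bochner_Integration.integral_add[OF intM' intM']
          Bochner_Integration.integral_add[OF intN' intN'] shift)
  qed (use plain in \<open>simp_all\<close>)
  have im: "(LINT \<omega>|M. (?P \<omega> * sin (?S a \<omega>)) * indicator (B k) (X k \<omega>))
      = (LINT \<omega>|N. (?Q \<omega> * sin (?T a \<omega>)) * indicator (B k) (Y k \<omega>))"
  proof (rule signed_weighted_uniqueness[OF assms(1,2)])
    show "\<bar>?P \<omega> * sin (?S a \<omega>)\<bar> \<le> 1" for \<omega>
      using mult_mono[OF P01 abs_sin_le_one[of "?S a \<omega>"]] by (simp add: abs_mult)
    show "\<bar>?Q \<omega> * sin (?T a \<omega>)\<bar> \<le> 1" for \<omega>
      using mult_mono[OF Q01 abs_sin_le_one[of "?T a \<omega>"]] by (simp add: abs_mult)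
    show "(CLINT \<omega>|M. of_real (?P \<omega> * sin (?S a \<omega>)) * iexp (t * X k \<omega>))
        = (CLINT \<omega>|N. of_real (?Q \<omega> * sin (?T a \<omega>)) * iexp (t * Y k \<omega>))" for t
      unfolding trig_sin unfolding neg
      by (simp only: integral_divide_zero Bochner_Integration.integral_diff[OF intM' intM']
          Bochner_Integration.integral_diff[OF intN' intN'] shift)
  qed (use plain in \<open>simp_all\<close>)
  have euler: "complex_of_real (\<Prod>j\<in>insert k J. indicator (B j) (Z j)) * iexp s
      = of_real ((\<Prod>j\<in>J. indicator (B j) (Z j)) * cos s * indicator (B k) (Z k))
        + \<i> * of_real ((\<Prod>j\<in>J. indicator (B j) (Z j)) * sin s * indicator (B k) (Z k))"
    for Z :: "'i \<Rightarrow> real" and s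
    using insert.hyps by (simp add: exp_Euler cos_of_real sin_of_real algebra_simps)
  have [simp]: "integrable M (\<lambda>\<omega>. ?P \<omega> * cos (?S a \<omega>) * indicator (B k) (X k \<omega>))"
      "integrable M (\<lambda>\<omega>. ?P \<omega> * sin (?S a \<omega>) * indicator (B k) (X k \<omega>))"
    by (rule bM; use mult_mono[OF P01 abs_cos_le_one] mult_mono[OF P01 abs_sin_le_one]
        in \<open>auto simp: abs_mult indicator_def[of "B k"]\<close>)+
  have [simp]: "integrable N (\<lambda>\<omega>. ?Q \<omega> * cos (?T a \<omega>) * indicator (B k) (Y k \<omega>))"
      "integrable N (\<lambda>\<omega>. ?Q \<omega> * sin (?T a \<omega>) * indicator (B k) (Y k \<omega>))"
    by (rule bN; use mult_mono[OF Q01 abs_cos_le_one] mult_mono[OF Q01 abs_sin_le_one]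
        in \<open>auto simp: abs_mult indicator_def[of "B k"]\<close>)+
  show ?case
    unfolding euler using re im by (simp del: of_real_mult of_real_prod)
qed

text \<open>The Cramer--Wold principle: the laws of all linear combinations determine the joint law, here
  on product events, which generate the product sigma-algebra. It is the case \<open>J = I\<close>, \<open>a = 0\<close> of the previous lemma.\<close>

theorem cramer_wold:
  fixes X :: "'i \<Rightarrow> 'a \<Rightarrow> real" and Y :: "'i \<Rightarrow> 'b \<Rightarrow> real"
  assumes "prob_space M" and "prob_space N" and I: "finite I"
    and [measurable]: "\<And>i. i \<in> I \<Longrightarrow> X i \<in> borel_measurable M"
      "\<And>i. i \<in> I \<Longrightarrow> Y i \<in> borel_measurable N"
    and law: "\<And>a. distr M borel (\<lambda>\<omega>. \<Sum>i\<in>I. a i * X i \<omega>) = distr N borel (\<lambda>\<omega>. \<Sum>i\<in>I. a i * Y i \<omega>)"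
    and [measurable]: "\<And>i. B i \<in> sets (borel :: real measure)"
  shows "\<P>(\<omega> in M. \<forall>i\<in>I. X i \<omega> \<in> B i) = \<P>(\<omega> in N. \<forall>i\<in>I. Y i \<omega> \<in> B i)"
proof -
  have eq: "(CLINT \<omega>|M. iexp (\<Sum>i\<in>I. a i * X i \<omega>)) = (CLINT \<omega>|N. iexp (\<Sum>i\<in>I. a i * Y i \<omega>))" for a
  proof -
    have "(CLINT x|distr M borel (\<lambda>\<omega>. \<Sum>i\<in>I. a i * X i \<omega>). iexp x)
        = (CLINT x|distr N borel (\<lambda>\<omega>. \<Sum>i\<in>I. a i * Y i \<omega>). iexp x)"
      by (simp only: law)
    then show ?thesis by (simp add: integral_distr)
  qed
  have prod_indicator: "(\<Prod>i\<in>I. indicator (B i) (Z i)) = (if \<forall>i\<in>I. Z i \<in> B i then 1 else 0 :: real)"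
    for Z using I by (auto simp: indicator_def)
  have prob: "(CLINT \<omega>|K. of_real (\<Prod>i\<in>I. indicator (B i) (Z i \<omega>)))
      = complex_of_real \<P>(\<omega> in K. \<forall>i\<in>I. Z i \<omega> \<in> B i)" for K :: "'k measure" and Z
  proof -
    have "(LINT \<omega>|K. (\<Prod>i\<in>I. indicator (B i) (Z i \<omega>))) = (LINT \<omega>|K. indicator {\<omega>\<in>space K. \<forall>i\<in>I. Z i \<omega> \<in> B i} \<omega> :: real)"
      unfolding prod_indicator by (intro Bochner_Integration.integral_cong) (auto simp: indicator_def)
    then show ?thesis unfolding integral_complex_of_real by (simp add: Int_def conj_commute)
  qed
  show ?thesis
    using indicator_iexp_uniqueness[OF assms(1-5) eq assms(7) subset_refl, where a = "\<lambda>_. 0"] prob[of M X] prob[of N Y]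
    by (simp del: of_real_prod)
qed

section \<open>Symmetry of centred Gaussian vectors\<close>

lemma gaussian_law_centered_symmetric:
  assumes D: "gaussian_law D" and mean: "(LINT x|D. x) = 0"
  shows "distr D borel uminus = D"
  using D unfolding gaussian_law_def
proof (elim disjE exE conjE)
  fix \<mu> \<sigma> :: real
  assume \<sigma>: "\<sigma> > 0" and D: "D = density lborel (normal_density \<mu> \<sigma>)"
  interpret D: prob_space D
    unfolding D by (rule prob_space_normal_density[OF \<sigma>])
  have dist: "distributed D lborel (\<lambda>x. x) (normal_density \<mu> \<sigma>)"
    unfolding distributed_def by (auto simp: D distr_id2)
  have "\<mu> = 0"
    using D.normal_distributed_expectation[OF \<sigma> dist] mean by simp
  then have "distributed D lborel (\<lambda>x. 0 + (- 1) * x) (normal_density (0 + (- 1) * 0) (\<bar>- 1\<bar> * \<sigma>))"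
    using dist \<sigma> by (intro D.normal_density_affine) auto
  then have "distr D lborel (\<lambda>x. - x) = density lborel (normal_density 0 \<sigma>)"
    by (simp add: distributed_def)
  moreover have "distr D lborel (\<lambda>x. - x) = distr D borel uminus"
    by (rule distr_cong) auto
  ultimately show ?thesis
    using \<open>\<mu> = 0\<close> D by simp
next
  fix \<mu> assume D: "D = return borel \<mu>"
  then have "\<mu> = 0" using mean by (simp add: integral_return)
  then show ?thesis by (simp add: D distr_return)
qed

text \<open>A linear combination of the row is Gaussian by definition, and it has mean zero because the
  entries do; hence it has the same law as its negative.\<close>

lemma gaussian_array_lin_comb_symmetric:
  assumes "prob_space M" and "gaussian_array M \<epsilon>"
  shows "distr M borel (\<lambda>\<omega>. \<Sum>j\<in>{1..p}. a j * \<epsilon> p j \<omega>)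
       = distr M borel (\<lambda>\<omega>. \<Sum>j\<in>{1..p}. a j * (- \<epsilon> p j \<omega>))"
proof -
  interpret prob_space M by fact
  let ?S = "\<lambda>\<omega>. \<Sum>j\<in>{1..p}. a j * \<epsilon> p j \<omega>"
  have gauss: "gaussian_law (distr M borel ?S)"
    and [measurable]: "\<And>j. j \<in> {1..p} \<Longrightarrow> \<epsilon> p j \<in> borel_measurable M"
    and std: "\<And>j. j \<in> {1..p} \<Longrightarrow> distributed M lborel (\<epsilon> p j) std_normal_density"
    using assms(2) unfolding gaussian_array_def jointly_gaussian_def by blast+
  have "integrable M (\<epsilon> p j)" if "j \<in> {1..p}" for j
    using distributed_integrable[OF std[OF that], of "\<lambda>x. x"] integrable_std_normal_moment[of 1] by simp
  moreover have "expectation (\<epsilon> p j) = 0" if "j \<in> {1..p}" for j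
    using normal_distributed_expectation[OF _ std[OF that]] by simp
  ultimately have "(LINT x|distr M borel ?S. x) = 0"
    by (simp add: integral_distr)
  then have "distr (distr M borel ?S) borel uminus = distr M borel ?S"
    by (rule gaussian_law_centered_symmetric[OF gauss])
  moreover have "distr (distr M borel ?S) borel uminus = distr M borel (\<lambda>\<omega>. - ?S \<omega>)"
    by (subst distr_distr) (auto simp: comp_def)
  ultimately show ?thesis by (simp add: sum_negf)
qed

text \<open>By Cramer--Wold the row and its negative have the same joint law, and
  a maximum exceeds \<open>x\<close> exactly off the product event that all coordinates lie in \<open>{..x}\<close>.\<close>

lemma prob_Max_uminus_gt:
  assumes "prob_space M" and "gaussian_array M \<epsilon>" and p: "p \<ge> 1"
  shows "\<P>(\<omega> in M. (MAX j\<in>{1..p}. - \<epsilon> p j \<omega>) > x) = \<P>(\<omega> in M. (MAX j\<in>{1..p}. \<epsilon> p j \<omega>) > x)"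
proof -
  interpret prob_space M by fact
  have meas [measurable]: "\<And>j. j \<in> {1..p} \<Longrightarrow> \<epsilon> p j \<in> borel_measurable M"
    using assms(2) unfolding gaussian_array_def jointly_gaussian_def by blast
  have compl: "\<P>(\<omega> in M. (MAX j\<in>{1..p}. Z j \<omega>) > x) = 1 - \<P>(\<omega> in M. \<forall>j\<in>{1..p}. Z j \<omega> \<in> {..x})"
    if [measurable]: "\<And>j. j \<in> {1..p} \<Longrightarrow> Z j \<in> borel_measurable M" for Z :: "nat \<Rightarrow> 'a \<Rightarrow> real"
  proof -
    have "\<P>(\<omega> in M. (MAX j\<in>{1..p}. Z j \<omega>) > x) = \<P>(\<omega> in M. \<not> (\<forall>j\<in>{1..p}. Z j \<omega> \<in> {..x}))"
      using p by (subst Max_gr_iff) (auto simp: not_le Bex_def)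
    also have "\<dots> = 1 - \<P>(\<omega> in M. \<forall>j\<in>{1..p}. Z j \<omega> \<in> {..x})"
      by (rule prob_neg) measurable
    finally show ?thesis .
  qed
  have "\<P>(\<omega> in M. \<forall>j\<in>{1..p}. \<epsilon> p j \<omega> \<in> {..x}) = \<P>(\<omega> in M. \<forall>j\<in>{1..p}. - \<epsilon> p j \<omega> \<in> {..x})"
    by (rule cramer_wold[OF assms(1,1)])
       (use gaussian_array_lin_comb_symmetric[OF assms(1,2)] in auto)
  then show ?thesis
    by (simp only: compl[of "\<epsilon> p"] compl[of "\<lambda>j \<omega>. - \<epsilon> p j \<omega>"] borel_measurable_uminus meas)
qed

section \<open>Growth of the normal quantiles\<close>

text \<open>Strictness, by positivity of the density, is what forces the quantiles \<open>u p\<close> to be unbounded.\<close>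

lemma std_normal_cdf_less_1: "cdf std_normal_distribution x < 1"
proof -
  interpret real_distribution std_normal_distribution by (rule real_dist_normal_dist)
  have "prob {x<..} \<noteq> 0"
  proof
    assume "prob {x<..} = 0"
    then have "{x<..} \<in> null_sets std_normal_distribution"
      by (simp add: null_sets_def emeasure_eq_measure)
    then have "AE y in lborel. y \<notin> {x<..}"
      by (subst (asm) null_sets_density_iff) (auto elim!: eventually_mono simp: normal_density_def)
    then have "{x<..} \<in> null_sets lborel"
      by (subst (asm) AE_iff_null_sets[symmetric]) auto
    then have "emeasure lborel {x<..x + 1} = 0"
      by (rule null_sets_subset[THEN null_setsD1]) auto
    then show False by simp
  qed
  moreover have "cdf std_normal_distribution x = 1 - prob {x<..}"
    unfolding cdf_def using prob_compl[of "{x<..}"] by (simp add: Compl_eq_Diff_UNIV[symmetric])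
  ultimately show ?thesis
    using measure_nonneg[of _ "{x<..}"] by (simp add: less_le)
qed

lemma cdf_std_normal_quantile:
  assumes "0 < q" "q < 1"
  shows "cdf std_normal_distribution (std_normal_quantile q) = q"
proof -
  interpret real_distribution std_normal_distribution by (rule real_dist_normal_dist)
  have no_atoms: "prob {x} = 0" for x
  proof -
    have "{x} \<in> null_sets std_normal_distribution"
      using AE_lborel_singleton[of x] by (subst null_sets_density_iff) (auto simp: frequently_def)
    then show ?thesis by (simp add: null_sets_def emeasure_eq_measure)
  qed
  have cont: "continuous_on {l..r} (cdf std_normal_distribution)" for l r
    by (intro continuous_at_imp_continuous_on ballI) (simp add: isCont_cdf no_atoms)
  obtain l where l: "cdf std_normal_distribution l \<le> q"
    using order_tendstoD(2)[OF cdf_lim_at_bot assms(1)]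
    unfolding eventually_at_bot_linorder by (meson less_imp_le order_refl)
  obtain r where r: "q \<le> cdf std_normal_distribution r"
    using order_tendstoD(1)[OF cdf_lim_at_top_prob assms(2)]
    unfolding eventually_at_top_linorder by (meson less_imp_le order_refl)
  have "\<exists>x. cdf std_normal_distribution x = q"
  proof (cases "l \<le> r")
    case True
    then show ?thesis
      using IVT'[OF l r True cont] by blast
  next
    case False
    then show ?thesis
      using cdf_nondecreasing[of r l] l r by (auto intro!: exI[of _ l])
  qed
  then show ?thesis
    unfolding std_normal_quantile_def by (metis f_inv_into_f rangeI)
qed

lemma filterlim_u_at_top: "filterlim u at_top sequentially"
proof (rule filterlim_at_top_gt[THEN iffD2], intro allI impI)
  fix K :: real
  interpret real_distribution std_normal_distribution by (rule real_dist_normal_dist)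
  have "(\<lambda>p. 1 - 1 / real p) \<longlonglongrightarrow> 1 - 0"
    by (intro tendsto_intros lim_1_over_n)
  then have "\<forall>\<^sub>F p in sequentially. cdf std_normal_distribution K < 1 - 1 / real p"
    using std_normal_cdf_less_1 by (intro order_tendstoD(1)) auto
  with eventually_gt_at_top[of 1] show "\<forall>\<^sub>F p in sequentially. K \<le> u p"
  proof eventually_elim
    case (elim p)
    then have "cdf std_normal_distribution (u p) = 1 - 1 / real p"
      unfolding u_def by (intro cdf_std_normal_quantile) (auto simp: field_simps)
    then show ?case
      using elim cdf_nondecreasing[of "u p" K] by fastforce
  qed
qed

section \<open>Maxima under even functions with monotone derivative\<close>

text \<open>The mean value inequality; since \<open>f'\<close> is monotone on the interval, its absolute value is
  largest at one of the two end points. This is where the maximum in \<open>d_star\<close> comes from.\<close>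

lemma monotone_deriv_increment_bound:
  fixes f :: "real \<Rightarrow> real"
  assumes diff: "\<And>x. f differentiable (at x)"
    and mono: "mono_on {a..b} (deriv f) \<or> antimono_on {a..b} (deriv f)"
    and "x \<in> {a..b}" "y \<in> {a..b}"
  shows "\<bar>f y - f x\<bar> \<le> max \<bar>deriv f a\<bar> \<bar>deriv f b\<bar> * \<bar>y - x\<bar>"
proof -
  have "norm (f y - f x) \<le> max \<bar>deriv f a\<bar> \<bar>deriv f b\<bar> * norm (y - x)"
  proof (rule field_differentiable_bound[of "{a..b}" f "deriv f"])
    show "(f has_field_derivative deriv f z) (at z within {a..b})" for z
      using diff[of z] by (metis DERIV_deriv_iff_real_differentiable has_field_derivative_at_within)
    show "norm (deriv f z) \<le> max \<bar>deriv f a\<bar> \<bar>deriv f b\<bar>" if "z \<in> {a..b}" for z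
      using mono
    proof
      assume "mono_on {a..b} (deriv f)"
      then have "deriv f a \<le> deriv f z" "deriv f z \<le> deriv f b"
        using that \<open>mono_on {a..b} (deriv f)\<close> by (auto intro: mono_onD)
      then show ?thesis by simp
    next
      assume "antimono_on {a..b} (deriv f)"
      then have "deriv f z \<le> deriv f a" "deriv f b \<le> deriv f z"
        using that monotone_onD[OF \<open>antimono_on {a..b} (deriv f)\<close>] by auto
      then show ?thesis by simp
    qed
  qed (use assms in auto)
  then show ?thesis by simp
qed

lemma Max_even_monotone:
  fixes f :: "real \<Rightarrow> real" and x :: "'i \<Rightarrow> real"
  assumes I: "finite I" "I \<noteq> {}"
    and even: "\<And>x. f x = f (- x)" and cont: "isCont f 0" and mono: "mono_on {0<..} f"
  shows "(MAX i\<in>I. f (x i)) = f (MAX i\<in>I. \<bar>x i\<bar>)"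
proof -
  \<comment> \<open>Some \<open>x i\<close> may vanish, so monotonicity has to be extended to the point 0, by continuity.\<close>
  have zero: "f 0 \<le> f b" if "b > 0" for b
  proof (rule tendsto_upperbound)
    show "(f \<longlongrightarrow> f 0) (at_right 0)"
      using cont by (simp add: isCont_def filterlim_at_split)
    show "\<forall>\<^sub>F y in at_right 0. f y \<le> f b"
      using eventually_at_right_real[OF that]
      by eventually_elim (use that in \<open>auto intro!: mono_onD[OF mono]\<close>)
  qed simp
  have le: "f a \<le> f b" if "0 \<le> a" "a \<le> b" for a b
    using zero[of b] mono_onD[OF mono, of a b] that by (cases "a = 0"; cases "b = 0") auto
  have abs: "f \<bar>y\<bar> = f y" for y
    using even[of y] by (simp add: abs_if)
  obtain k where k: "k \<in> I" "(MAX i\<in>I. \<bar>x i\<bar>) = \<bar>x k\<bar>"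
    using obtains_MAX[OF I, of "\<lambda>i. \<bar>x i\<bar>"] by metis
  show ?thesis
  proof (rule Max_eqI)
    show "f (MAX i\<in>I. \<bar>x i\<bar>) \<in> (\<lambda>i. f (x i)) ` I"
      using k by (simp add: abs)
    fix y assume "y \<in> (\<lambda>i. f (x i)) ` I"
    then obtain i where i: "i \<in> I" "y = f \<bar>x i\<bar>" by (auto simp: abs)
    show "y \<le> f (MAX i\<in>I. \<bar>x i\<bar>)"
      unfolding i(2) using I i(1) by (intro le) auto
  qed (use I in simp)
qed

section \<open>Transfer of relative stability\<close>

theorem corollary4p1:
  fixes M :: "'a measure"
    and \<epsilon> \<eta> :: "nat \<Rightarrow> nat \<Rightarrow> 'a \<Rightarrow> real"
    and f :: "real \<Rightarrow> real"
    and v \<delta> d :: "nat \<Rightarrow> real"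
    and L :: ereal
  assumes "prob_space M"
    and "gaussian_array M \<epsilon>"
    and "URS M \<epsilon>"
    and "\<And>x. f x = f (- x)"
    and "\<And>x. f differentiable (at x)"
    and "\<exists>x0. strict_mono_on {x0..} f"
    and "((\<lambda>x. ereal (f x)) \<longlongrightarrow> L) at_top" and "L \<noteq> 0"
    and "mono_on {0<..} f"
    and "(\<exists>x0. mono_on {x0..} (deriv f)) \<or> (\<exists>x0. antimono_on {x0..} (deriv f))"
    and "\<And>p j \<omega>. \<eta> p j \<omega> = f (\<epsilon> p j \<omega>)"
    and "\<And>p. v p = f (u p)"
    and "\<forall>\<^sub>F p in sequentially. \<delta> p > 0"
    and "\<delta> \<longlonglongrightarrow> 0"
    and "(\<lambda>p. \<P>(\<omega> in M. \<bar>(MAX j\<in>{1..p}. \<epsilon> p j \<omega>) / u p - 1\<bar> > \<delta> p)) \<longlonglongrightarrow> 0"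
    and "\<forall>\<^sub>F p in sequentially. d p \<ge> d_star f \<delta> p"
  shows "(\<lambda>p. \<P>(\<omega> in M. \<bar>(MAX j\<in>{1..p}. \<eta> p j \<omega>) / v p - 1\<bar> > d p)) \<longlonglongrightarrow> 0"
proof -
  interpret prob_space M by fact
  have meas [measurable]: "\<epsilon> p j \<in> borel_measurable M" if "j \<in> {1..p}" for p j
    using assms(2) that unfolding gaussian_array_def jointly_gaussian_def by blast
  let ?X = "\<lambda>p \<omega>. MAX j\<in>{1..p}. \<epsilon> p j \<omega>" and ?Y = "\<lambda>p \<omega>. MAX j\<in>{1..p}. - \<epsilon> p j \<omega>"
  define q where "q p = \<P>(\<omega> in M. \<bar>?X p \<omega> / u p - 1\<bar> > \<delta> p)" for p
  have large: "\<forall>\<^sub>F p in sequentially. K < u p" for K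
    using filterlim_u_at_top by (simp add: filterlim_at_top_dense)
  obtain x1 where x1: "mono_on {x1..} (deriv f) \<or> antimono_on {x1..} (deriv f)"
    using assms(10) by blast
  have nonzero: "\<forall>\<^sub>F p in sequentially. f (u p) \<noteq> 0"
  proof -
    obtain x0 where x0: "strict_mono_on {x0..} f" using assms(6) by blast
    show ?thesis
    proof (cases "\<exists>z\<ge>x0. f z = 0")
      case True
      then obtain z where z: "z \<ge> x0" "f z = 0" by blast
      from large[of z] show ?thesis
        by eventually_elim (use z strict_mono_onD[OF x0, of z] in force)
    next
      case False
      from large[of x0] show ?thesis
        by eventually_elim (use False in force)
    qed
  qed
  have "\<forall>\<^sub>F p in sequentially. \<delta> p < 1 / 2"
    using assms(14) by (rule order_tendstoD) simp
  with assms(13) assms(16) nonzero large[of "max 0 (2 * x1)"] eventually_ge_at_top[of 1]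
  have bound: "\<forall>\<^sub>F p in sequentially.
      \<P>(\<omega> in M. \<bar>(MAX j\<in>{1..p}. \<eta> p j \<omega>) / v p - 1\<bar> > d p) \<le> q p + q p"
  proof eventually_elim
    case (elim p)
    let ?a = "u p * (1 - \<delta> p)" and ?b = "u p * (1 + \<delta> p)"
    have u: "u p > 0" using elim by simp
    have "x1 \<le> u p / 2" using elim by simp
    also have "u p / 2 \<le> ?a"
      using mult_left_mono[of "1 / 2" "1 - \<delta> p" "u p"] elim u by simp
    finally have x1a: "x1 \<le> ?a" .
    have dev: "\<bar>y / u p - 1\<bar> > \<delta> p \<longleftrightarrow> y < ?a \<or> y > ?b" for y
      using u by (auto simp: abs_if field_simps)
    have good: "\<bar>(MAX j\<in>{1..p}. \<eta> p j \<omega>) / v p - 1\<bar> \<le> d p"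
      if "\<not> \<bar>?X p \<omega> / u p - 1\<bar> > \<delta> p" and neg: "\<not> ?Y p \<omega> > ?b" for \<omega>
    proof -
      let ?m = "MAX j\<in>{1..p}. \<bar>\<epsilon> p j \<omega>\<bar>"
      \<comment> \<open>The lower bound on \<open>?m\<close> comes from the maximum of the row alone, the upper bound needs
        its minimum as well.\<close>
      have X: "?a \<le> ?X p \<omega>" "?X p \<omega> \<le> ?b" using that(1) unfolding dev by auto
      have ne: "finite {1..p}" "{1..p} \<noteq> {}" using elim by auto
      have "?m \<le> ?b"
      proof (subst Max_le_iff)
        show "\<forall>a\<in>(\<lambda>j. \<bar>\<epsilon> p j \<omega>\<bar>) ` {1..p}. a \<le> ?b"
        proof safe
          fix j assume j: "j \<in> {1..p}"
          have "\<epsilon> p j \<omega> \<le> ?X p \<omega>" "- \<epsilon> p j \<omega> \<le> ?Y p \<omega>" using j by (auto intro: Max_ge)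
          then show "\<bar>\<epsilon> p j \<omega>\<bar> \<le> ?b" using X neg by linarith
        qed
      qed (use ne in auto)
      moreover have "?a \<le> ?m"
      proof -
        obtain j where j: "j \<in> {1..p}" "?X p \<omega> = \<epsilon> p j \<omega>"
          using obtains_MAX[OF ne] by metis
        then have "?X p \<omega> \<le> \<bar>\<epsilon> p j \<omega>\<bar>" by simp
        also have "\<dots> \<le> ?m" using j by (auto intro: Max_ge)
        finally show ?thesis using X by simp
      qed
      ultimately have m: "?m \<in> {?a..?b}" by simp
      have cont: "isCont f 0"
        using assms(5) by (simp add: differentiable_imp_continuous_within)
      have "(MAX j\<in>{1..p}. \<eta> p j \<omega>) = f ?m"
        unfolding assms(11) by (rule Max_even_monotone[OF ne assms(4) cont assms(9)])
      then have "\<bar>(MAX j\<in>{1..p}. \<eta> p j \<omega>) / v p - 1\<bar> = \<bar>f ?m - f (u p)\<bar> / \<bar>f (u p)\<bar>"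
        using elim by (simp add: assms(12) diff_divide_distrib flip: abs_divide)
      also have "\<bar>f ?m - f (u p)\<bar> \<le> max \<bar>deriv f ?a\<bar> \<bar>deriv f ?b\<bar> * \<bar>?m - u p\<bar>"
      proof (rule monotone_deriv_increment_bound[OF assms(5) _ _ m])
        show "mono_on {?a..?b} (deriv f) \<or> antimono_on {?a..?b} (deriv f)"
          using x1 monotone_on_subset[of "{x1..}" _ _ "deriv f" "{?a..?b}"] x1a by auto
        show "u p \<in> {?a..?b}" using elim u by (auto simp: algebra_simps)
      qed
      also have "\<dots> \<le> max \<bar>deriv f ?a\<bar> \<bar>deriv f ?b\<bar> * (u p * \<delta> p)"
        using m by (intro mult_left_mono) (auto simp: abs_le_iff algebra_simps)
      finally have "\<bar>(MAX j\<in>{1..p}. \<eta> p j \<omega>) / v p - 1\<bar> \<le> d_star f \<delta> p"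
        unfolding d_star_def by (simp add: divide_right_mono mult_ac)
      then show ?thesis using elim by simp
    qed
    have "\<P>(\<omega> in M. \<bar>(MAX j\<in>{1..p}. \<eta> p j \<omega>) / v p - 1\<bar> > d p)
        \<le> \<P>(\<omega> in M. \<bar>?X p \<omega> / u p - 1\<bar> > \<delta> p \<or> ?Y p \<omega> > ?b)"
      by (rule finite_measure_mono) (use good in \<open>auto simp flip: not_le\<close>)
    also have "\<dots> \<le> \<P>(\<omega> in M. \<bar>?X p \<omega> / u p - 1\<bar> > \<delta> p) + \<P>(\<omega> in M. ?Y p \<omega> > ?b)"
      by (rule order_trans[OF _ measure_Un_le]) (auto intro!: finite_measure_mono)
    also have "\<P>(\<omega> in M. ?Y p \<omega> > ?b) = \<P>(\<omega> in M. ?X p \<omega> > ?b)"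
      using elim by (intro prob_Max_uminus_gt assms(1,2)) auto
    also have "\<dots> \<le> q p"
      unfolding q_def by (rule finite_measure_mono) (auto simp: dev)
    finally show ?case by (simp add: q_def)
  qed
  have "(\<lambda>p. q p + q p) \<longlonglongrightarrow> 0 + 0"
    using assms(15) unfolding q_def by (intro tendsto_add)
  then show ?thesis
    by (intro tendsto_sandwich[OF _ bound tendsto_const]) auto
qed

end
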